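(* Let $\mathcal{A}=\sum_{i=1}^N A^{(i)}\frac{\partial}{\partial x_i}$, with $A^{(i)}\in\mathbb{R}^{m\times d}$, be a first order linear differential operator with constant coefficients satisfying $\mathrm{rank}\left(\sum_{i=1}^N A^{(i)}w_i\right)=m$ for every $w\in\mathbb{R}^N\setminus\{0\}$. Let $\Omega\subset\mathbb{R}^N$ be a bounded open set and let $F:\mathbb{R}^d\to\mathbb{R}$ be continuous and $\mathcal{A}$-quasiconvex. Let $E,K\subset\mathbb{R}^d$ be such that $$E=\{\xi\in\mathbb{R}^d: F(\xi)=0\},\qquad K\subset\{\xi\in\mathbb{R}^d: F(\xi)\le 0\},$$ with $\mathrm{int}\,K\neq\emptyset$. Assume that $K$ has the relaxation property with respect to $E$, and that $E$ and $K$ are both bounded. Then, if $\xi\in E\cup\mathrm{int}\,K$, there exists $u\in L^\infty(\mathbb{R}^N;\mathbb{R}^d)$ with $\mathcal{A}u=0$ in $\mathcal{D}'(\mathbb{R}^N;\mathbb{R}^m)$ such that $$F(u(x))=0\ \text{ for a.e. } x\in\Omega,\qquad u=\xi\ \text{ in } \mathbb{R}^N\setminus\Omega.$$ Moreover there is a dense set of such $u$: the set of such functions $u$ belonging to $\overline{V}$ is dense in $\overline{V}$ for the weak* topology of $L^\infty(\mathbb{R}^N;\mathbb{R}^d)$, where $\overline{V}$ is the weak* closure in $L^\infty(\mathbb{R}^N;\mathbb{R}^d)$ of $$V=\{u\in L^\infty_{\rm piec}(\mathbb{R}^N;\mathbb{R}^d):\ \mathcal{A}u=0 \text{ in } \mathcal{D}'(\mathbb{R}^N;\mathbb{R}^m),\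 u=\xi\text{ in }\mathbb{R}^N\setminus\Omega,\ u(x)\in E\cup\mathrm{int}\,K\text{ for a.e. }x\in\Omega\}.$$
   Context: Notation: $\mathrm{int}\,K$ is the interior of $K$; $\mathrm{dist}(\cdot;E)$ is the Euclidean distance to $E$ in $\mathbb{R}^d$; $Q=(0,1)^N$ is the unit cube; a.e. refers to Lebesgue measure; $\stackrel{*}{\rightharpoonup}$ denotes weak* convergence in $L^\infty$. $L^\infty_{\rm piec}(\mathbb{R}^N;\mathbb{R}^d)$ is the set of bounded piecewise constant functions, i.e. bounded functions for which there are at most countably many pairwise disjoint open sets, covering $\mathbb{R}^N$ up to a null set, on each of which the function is constant. $\mathcal{A}$-quasiconvexity: a Borel measurable function $F:\mathbb{R}^d\to\mathbb{R}$ is $\mathcal{A}$-quasiconvex if $F(\xi)\le\int_Q F(\xi+w(x))\,dx$ for every $\xi\in\mathbb{R}^d$ and every $Q$-periodic $w\in C^\infty(\mathbb{R}^N;\mathbb{R}^d)$ with $\mathcal{A}w=0$ in $\mathbb{R}^N$ and $\int_Q w\,dx=0$. Relaxation property: $K\subset\mathbb{R}^d$ has the relaxation property with respect to $E\subset\mathbb{R}^d$ if for every bounded open set $\Omega\subset\mathbb{R}^N$ and every $\xi\in\mathrm{int}\,K$ there exists a sequence $\{u_n\}\subset L^\infty_{\rm piec}(\mathbb{R}^N;\mathbb{R}^d)$ such that $u_n\stackrel{*}{\rightharpoonup}\xi$; $u_n=\xi$ in $\mathbb{R}^N\setminus\Omega$; $\mathcal{A}u_n=0$ in $\mathcal{D}'(\mathbb{R}^N;\mathbb{R}^m)$;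 $u_n(x)\in E\cup\mathrm{int}\,K$ for a.e. $x\in\Omega$; and $\int_\Omega\mathrm{dist}(u_n(x);E)\,dx\to0$ as $n\to\infty$. *)

theory Defs
  imports "HOL-Analysis.Analysis"
begin

definition partial :: "'n::finite \<Rightarrow> (real^'n \<Rightarrow> 'b::real_normed_vector) \<Rightarrow> real^'n \<Rightarrow> 'b" where
  "partial i f x = frechet_derivative f (at x) (axis i 1)"

primrec C_k :: "nat \<Rightarrow> (real^'n \<Rightarrow> 'b::real_normed_vector) \<Rightarrow> bool" where
  "C_k 0 f \<longleftrightarrow> continuous_on UNIV f"
| "C_k (Suc k) f \<longleftrightarrow> (\<forall>x. f differentiable (at x)) \<and> (\<forall>i. C_k k (partial i f))"

definition smooth :: "(real^'n \<Rightarrow> 'b::real_normed_vector) \<Rightarrow> bool" where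
  "smooth f \<longleftrightarrow> (\<forall>k. C_k k f)"

text \<open>A family \<open>A\<close> of \<open>m \<times> d\<close> matrices stands for the operator
  \<open>\<Sum>i. A i \<partial>/\<partial>x\<^sub>i\<close>; the dimensions \<open>N\<close>, \<open>d\<close>, \<open>m\<close> are the cardinalities of the index
  types \<open>'n\<close>, \<open>'d\<close>, \<open>'m\<close>.\<close>

definition full_rank_symbol :: "('n::finite \<Rightarrow> real^'d^'m) \<Rightarrow> bool" where
  "full_rank_symbol A \<longleftrightarrow>
     (\<forall>w::real^'n. w \<noteq> 0 \<longrightarrow> rank (\<Sum>i\<in>UNIV. (w $ i) *\<^sub>R A i) = CARD('m))"

definition diff_op :: "('n::finite \<Rightarrow> real^'d^'m) \<Rightarrow> (real^'n \<Rightarrow> real^'d) \<Rightarrow> real^'n \<Rightarrow> real^'m" where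
  "diff_op A w x = (\<Sum>i\<in>UNIV. A i *v partial i w x)"

text \<open>\<open>\<A> u = 0\<close> in the sense of distributions, for locally integrable \<open>u\<close>: the test functions
  are the smooth compactly supported maps into \<open>\<real>\<^sup>m\<close>, and the derivatives have been moved onto
  them.\<close>

definition distr_free :: "('n::finite \<Rightarrow> real^'d^'m) \<Rightarrow> (real^'n \<Rightarrow> real^'d) \<Rightarrow> bool" where
  "distr_free A u \<longleftrightarrow>
     (\<forall>\<phi> :: real^'n \<Rightarrow> real^'m. smooth \<phi> \<and> compact (closure {x. \<phi> x \<noteq> 0}) \<longrightarrow>
        (LINT x|lebesgue. (\<Sum>i\<in>UNIV. (A i *v u x) \<bullet> partial i \<phi> x)) = 0)"

text \<open>Elements of \<open>L\<^sup>\<infinity>\<close> are represented by functions rather than by classes modulo equality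
  almost everywhere. The weak* topology below does not separate functions that agree almost
  everywhere, so closures, density and limits are those of the quotient.\<close>

definition L_inf :: "(real^'n \<Rightarrow> real^'d) set" where
  "L_inf = {u. u \<in> borel_measurable lebesgue \<and> (\<exists>C. AE x in lebesgue. norm (u x) \<le> C)}"

definition L_1 :: "(real^'n \<Rightarrow> real^'d) set" where
  "L_1 = {g. integrable lebesgue g}"

text \<open>The coarsest topology on \<open>L\<^sup>\<infinity>\<close> for which \<open>u \<mapsto> \<integral> u \<bullet> g\<close> is continuous for every
  \<open>g \<in> L\<^sup>1\<close>.\<close>

definition weak_star :: "(real^'n \<Rightarrow> real^'d) topology" where
  "weak_star = pullback_topology L_inf
     (\<lambda>u. \<lambda>g\<in>L_1. LINT x|lebesgue. u x \<bullet> g x)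
     (product_topology (\<lambda>_. euclideanreal) L_1)"

lemma topspace_weak_star: "topspace weak_star = L_inf"
  by (auto simp: weak_star_def topspace_pullback_topology)

lemma limitin_weak_star:
  assumes u: "\<And>n. u n \<in> L_inf" and v: "v \<in> L_inf"
  shows "limitin weak_star u v sequentially \<longleftrightarrow>
    (\<forall>g\<in>L_1. (\<lambda>n. LINT x|lebesgue. u n x \<bullet> g x) \<longlonglongrightarrow> (LINT x|lebesgue. v x \<bullet> g x))"
proof -
  let ?J = "\<lambda>u. \<lambda>g\<in>L_1. LINT x|lebesgue. u x \<bullet> g x"
  have "limitin weak_star u v sequentially \<longleftrightarrow>
      limitin (product_topology (\<lambda>_. euclideanreal) L_1) (\<lambda>n. ?J (u n)) (?J v) sequentially"
  proof -
    have "(\<forall>S. openin weak_star S \<and> v \<in> S \<longrightarrow> (\<forall>\<^sub>F n in sequentially. u n \<in> S)) \<longleftrightarrow>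
        (\<forall>U. openin (product_topology (\<lambda>_. euclideanreal) L_1) U \<and> ?J v \<in> U \<longrightarrow>
          (\<forall>\<^sub>F n in sequentially. ?J (u n) \<in> U))"
    proof (intro iffI allI impI)
      fix U
      assume L: "\<forall>S. openin weak_star S \<and> v \<in> S \<longrightarrow> (\<forall>\<^sub>F n in sequentially. u n \<in> S)"
        and U: "openin (product_topology (\<lambda>_. euclideanreal) L_1) U \<and> ?J v \<in> U"
      have "openin weak_star (?J -` U \<inter> L_inf)"
        unfolding weak_star_def openin_pullback_topology using U by blast
      then have "\<forall>\<^sub>F n in sequentially. u n \<in> ?J -` U \<inter> L_inf"
        using L U v by blast
      then show "\<forall>\<^sub>F n in sequentially. ?J (u n) \<in> U"
        by eventually_elim blast
    next
      fix S
      assume R: "\<forall>U. openin (product_topology (\<lambda>_. euclideanreal) L_1) U \<and> ?J v \<in> U \<longrightarrow>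
          (\<forall>\<^sub>F n in sequentially. ?J (u n) \<in> U)"
        and S: "openin weak_star S \<and> v \<in> S"
      then obtain U where U: "openin (product_topology (\<lambda>_. euclideanreal) L_1) U"
          "S = ?J -` U \<inter> L_inf"
        unfolding weak_star_def openin_pullback_topology by blast
      then have "\<forall>\<^sub>F n in sequentially. ?J (u n) \<in> U"
        using R S by blast
      then show "\<forall>\<^sub>F n in sequentially. u n \<in> S"
        unfolding U(2) by eventually_elim (use u in blast)
    qed
    moreover have "?J v \<in> topspace (product_topology (\<lambda>_. euclideanreal) L_1)"
      by simp
    ultimately show ?thesis
      unfolding limitin_def topspace_weak_star using v by blast
  qed
  also have "\<dots> \<longleftrightarrow>
    (\<forall>g\<in>L_1. (\<lambda>n. LINT x|lebesgue. u n x \<bullet> g x) \<longlonglongrightarrow> (LINT x|lebesgue. v x \<bullet> g x))"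
    by (simp add: limitin_componentwise)
  finally show ?thesis .
qed

definition L_inf_piec :: "(real^'n \<Rightarrow> real^'d) set" where
  "L_inf_piec = {u. bounded (range u) \<and>
     (\<exists>D. countable D \<and> disjoint D \<and> (\<forall>U\<in>D. open U \<and> u constant_on U) \<and>
          negligible (- \<Union>D))}"

definition unit_cube :: "(real^'n) set" where
  "unit_cube = box 0 One"

text \<open>If \<open>F\<close> is continuous, the last integrand is bounded; for a merely Borel \<open>F\<close> it need
  not be integrable, and the integral is then \<open>0\<close> by the library's convention.\<close>

definition A_quasiconvex :: "('n::finite \<Rightarrow> real^'d^'m) \<Rightarrow> (real^'d \<Rightarrow> real) \<Rightarrow> bool" where
  "A_quasiconvex A F \<longleftrightarrow> F \<in> borel_measurable borel \<and>
     (\<forall>\<xi>. \<forall>w :: real^'n \<Rightarrow> real^'d.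
        smooth w \<and> (\<forall>x i. w (x + axis i 1) = w x) \<and> (\<forall>x. diff_op A w x = 0) \<and>
        (LINT x:unit_cube|lebesgue. w x) = 0 \<longrightarrow>
        F \<xi> \<le> (LINT x:unit_cube|lebesgue. F (\<xi> + w x)))"

text \<open>The distance to a set, with the convention that it is infinite when the set is empty;
  \<open>infdist\<close> would be \<open>0\<close> there, which would make the relaxation property below hold for
  \<open>E = {}\<close>.\<close>

definition edist_to :: "'a::metric_space \<Rightarrow> 'a set \<Rightarrow> ennreal" where
  "edist_to x E = (INF e\<in>E. ennreal (dist x e))"

lemma edist_to_infdist:
  assumes "E \<noteq> {}"
  shows "edist_to x E = ennreal (infdist x E)"
proof (rule antisym)
  show "ennreal (infdist x E) \<le> edist_to x E"
    unfolding edist_to_def by (intro INF_greatest ennreal_leI infdist_le)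
  show "edist_to x E \<le> ennreal (infdist x E)"
  proof (rule ennreal_le_epsilon)
    fix e :: real
    assume "0 < e"
    have "bdd_below (dist x ` E)"
      by (rule bdd_belowI[of _ 0]) auto
    moreover have "Inf (dist x ` E) < infdist x E + e"
      using \<open>0 < e\<close> assms by (simp add: infdist_notempty)
    ultimately obtain a where "a \<in> E" "dist x a < infdist x E + e"
      using assms by (auto simp: cInf_less_iff)
    then have "edist_to x E \<le> ennreal (infdist x E + e)"
      unfolding edist_to_def by (intro INF_lower2[of a] ennreal_leI) auto
    then show "edist_to x E \<le> ennreal (infdist x E) + ennreal e"
      using \<open>0 < e\<close> by (simp add: infdist_nonneg)
  qed
qed

definition relaxation_property ::
  "('n::finite \<Rightarrow> real^'d^'m) \<Rightarrow> (real^'d) set \<Rightarrow> (real^'d) set \<Rightarrow> bool" where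
  "relaxation_property A K E \<longleftrightarrow>
     (\<forall>\<Omega> :: (real^'n) set. \<forall>\<xi>. bounded \<Omega> \<and> open \<Omega> \<and> \<xi> \<in> interior K \<longrightarrow>
        (\<exists>u :: nat \<Rightarrow> real^'n \<Rightarrow> real^'d.
           (\<forall>n. u n \<in> L_inf_piec) \<and>
           limitin weak_star u (\<lambda>_. \<xi>) sequentially \<and>
           (\<forall>n. AE x in lebesgue. x \<notin> \<Omega> \<longrightarrow> u n x = \<xi>) \<and>
           (\<forall>n. distr_free A (u n)) \<and>
           (\<forall>n. AE x in lebesgue. x \<in> \<Omega> \<longrightarrow> u n x \<in> E \<union> interior K) \<and>
           (\<lambda>n. \<integral>\<^sup>+x\<in>\<Omega>. edist_to (u n x) E \<partial>lebesgue) \<longlonglongrightarrow> 0))"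

definition V_set ::
  "('n::finite \<Rightarrow> real^'d^'m) \<Rightarrow> (real^'n) set \<Rightarrow> (real^'d) set \<Rightarrow> (real^'d) set \<Rightarrow> real^'d
     \<Rightarrow> (real^'n \<Rightarrow> real^'d) set" where
  "V_set A \<Omega> E K \<xi> = {u \<in> L_inf_piec. distr_free A u \<and>
     (AE x in lebesgue. x \<notin> \<Omega> \<longrightarrow> u x = \<xi>) \<and>
     (AE x in lebesgue. x \<in> \<Omega> \<longrightarrow> u x \<in> E \<union> interior K)}"

definition solutions ::
  "('n::finite \<Rightarrow> real^'d^'m) \<Rightarrow> (real^'n) set \<Rightarrow> (real^'d \<Rightarrow> real) \<Rightarrow> real^'d
     \<Rightarrow> (real^'n \<Rightarrow> real^'d) set" where
  "solutions A \<Omega> F \<xi> = {u \<in> L_inf. distr_free A u \<and>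
     (AE x in lebesgue. x \<in> \<Omega> \<longrightarrow> F (u x) = 0) \<and>
     (AE x in lebesgue. x \<notin> \<Omega> \<longrightarrow> u x = \<xi>)}"

end

theory Submission
  imports Defs
begin

text \<open>Applying the relaxation property on finitely many pieces of \<open>u \<in> V\<close>, which carry all but a
  small part of the measure of \<open>\<Omega>\<close>, gives elements of \<open>V\<close> that are weak* close to \<open>u\<close> and have
  small \<open>\<integral> dist(\<cdot>; E)\<close>. Iterate this, and make \<open>u\<^sub>k\<^sub>+\<^sub>1 - u\<^sub>k\<close> almost orthogonal in \<open>L\<^sup>2(\<Omega>)\<close>
  to \<open>u\<^sub>0, \<dots>, u\<^sub>k\<close>: each \<open>1\<^sub>\<Omega> u\<^sub>j\<close> is in \<open>L\<^sup>1\<close>, hence a legitimate weak* test. Then the numbers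
  \<open>\<parallel>u\<^sub>k\<parallel>\<^sup>2\<close> are bounded and increasing up to a summable error, and they control
  \<open>\<parallel>u\<^sub>m - u\<^sub>k\<parallel>\<^sup>2\<close>, so that \<open>(u\<^sub>k)\<close> converges strongly and the limit takes its values in \<open>E\<close>.
  This replaces the usual Baire category argument with weak* lower semicontinuity.\<close>

section \<open>Pairings with integrable maps and weak* neighbourhoods\<close>

abbreviation pairing :: "(real^'n \<Rightarrow> real^'d) \<Rightarrow> (real^'n \<Rightarrow> real^'d) \<Rightarrow> real" where
  "pairing u g \<equiv> LINT x|lebesgue. u x \<bullet> g x"

lemma const_in_L_inf: "(\<lambda>_. c) \<in> L_inf"
  by (auto simp: L_inf_def)

lemma integrable_inner_L_inf_L_1:
  assumes "u \<in> L_inf" "g \<in> L_1"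
  shows "integrable lebesgue (\<lambda>x. u x \<bullet> g x)"
proof -
  obtain C where [measurable]: "u \<in> borel_measurable lebesgue"
    and C: "AE x in lebesgue. norm (u x) \<le> C"
    using assms by (auto simp: L_inf_def)
  have [measurable]: "integrable lebesgue g"
    using assms by (simp add: L_1_def)
  show ?thesis
  proof (rule Bochner_Integration.integrable_bound)
    show "integrable lebesgue (\<lambda>x. C *\<^sub>R norm (g x))"
      using \<open>integrable lebesgue g\<close> by (intro integrable_scaleR_right integrable_norm)
    show "AE x in lebesgue. norm (u x \<bullet> g x) \<le> norm (C *\<^sub>R norm (g x))"
      using C
    proof eventually_elim
      case (elim x)
      have "norm (u x \<bullet> g x) \<le> norm (u x) * norm (g x)"
        by (simp add: Cauchy_Schwarz_ineq2)
      also have "\<dots> \<le> \<bar>C\<bar> * norm (g x)"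
        using elim by (intro mult_right_mono) auto
      finally show ?case
        by (simp add: abs_mult)
    qed
  qed measurable
qed

text \<open>A basic open set of the product topology restricts only finitely many coordinates, so
  its pullback is a condition on finitely many pairings. The minimum of their radii serves all of
  them.\<close>

lemma weak_star_nhd:
  fixes T :: "(real^'n \<Rightarrow> real^'d) set"
  assumes "openin weak_star T" "v \<in> T"
  obtains G e where "finite G" "G \<subseteq> L_1" "e > 0"
    "\<forall>u\<in>L_inf. (\<forall>g\<in>G. \<bar>pairing u g - pairing v g\<bar> < e) \<longrightarrow> u \<in> T"
proof -
  let ?J = "\<lambda>u :: real^'n \<Rightarrow> real^'d. \<lambda>g\<in>L_1. pairing u g"
  obtain U where U: "openin (product_topology (\<lambda>_. euclideanreal) L_1) U" "T = ?J -` U \<inter> L_inf"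
    using assms unfolding weak_star_def openin_pullback_topology by blast
  have "?J v \<in> U"
    using U assms by blast
  then obtain V where V: "finite {g\<in>L_1. V g \<noteq> UNIV}" "\<And>g. g \<in> L_1 \<Longrightarrow> open (V g)"
      "?J v \<in> Pi\<^sub>E L_1 V" "Pi\<^sub>E L_1 V \<subseteq> U"
    using U(1) unfolding openin_product_topology_alt by auto
  define G where "G = {g\<in>L_1. V g \<noteq> UNIV}"
  have "\<exists>e>0. \<forall>y. \<bar>y - pairing v g\<bar> < e \<longrightarrow> y \<in> V g" if "g \<in> L_1" for g
  proof -
    have "pairing v g \<in> V g"
      using PiE_mem[OF V(3) that] that by simp
    then show ?thesis
      using V(2)[OF that] unfolding open_real by blast
  qed
  then obtain d where d: "\<And>g. g \<in> L_1 \<Longrightarrow> d g > 0"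
      "\<And>g y. g \<in> L_1 \<Longrightarrow> \<bar>y - pairing v g\<bar> < d g \<Longrightarrow> y \<in> V g"
    by metis
  \<comment> \<open>The extra 1 keeps the minimum defined when no pairing is constrained.\<close>
  define e where "e = Min (insert 1 (d ` G))"
  have G: "finite G" "G \<subseteq> L_1"
    using V(1) by (auto simp: G_def)
  show ?thesis
  proof (rule that[OF G])
    show "e > 0"
      using G d(1) by (auto simp: e_def)
    show "\<forall>u\<in>L_inf. (\<forall>g\<in>G. \<bar>pairing u g - pairing v g\<bar> < e) \<longrightarrow> u \<in> T"
    proof (intro ballI impI)
      fix u :: "real^'n \<Rightarrow> real^'d"
      assume u: "u \<in> L_inf" and close: "\<forall>g\<in>G. \<bar>pairing u g - pairing v g\<bar> < e"
      have "?J u \<in> Pi\<^sub>E L_1 V"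
      proof (rule PiE_I)
        fix g :: "real^'n \<Rightarrow> real^'d"
        assume g: "g \<in> L_1"
        show "?J u g \<in> V g"
        proof (cases "g \<in> G")
          case True
          have "\<bar>pairing u g - pairing v g\<bar> < d g"
            using close G(1) True by (auto simp: e_def)
          then show ?thesis
            using d(2) g by simp
        qed (use g in \<open>auto simp: G_def\<close>)
      qed simp
      then show "u \<in> T"
        using V(4) U(2) u by blast
    qed
  qed
qed

text \<open>Every weak* neighbourhood of the limit contains a tail of the sequence.\<close>

lemma closure_of_weak_star_sequentially:
  assumes S: "S \<subseteq> L_inf" and u: "\<And>n. u n \<in> S" and v: "v \<in> L_inf"
    and lim: "\<And>g. g \<in> L_1 \<Longrightarrow> (\<lambda>n. pairing (u n) g) \<longlonglongrightarrow> pairing v g"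
  shows "v \<in> weak_star closure_of S"
proof -
  have "limitin weak_star u v sequentially"
    using limitin_weak_star[of u v] u S v lim by blast
  then have "\<exists>y\<in>S. y \<in> T" if "v \<in> T" "openin weak_star T" for T
    using that u unfolding limitin_def eventually_sequentially by blast
  then show ?thesis
    unfolding in_closure_of topspace_weak_star using v by blast
qed

text \<open>Dominated convergence with majorant \<open>C * norm (g x)\<close>. It leads from the
  almost everywhere convergence of a construction to its weak* convergence.\<close>

lemma pairing_tendsto_dominated:
  assumes u: "\<And>n. u n \<in> borel_measurable lebesgue" and v: "v \<in> borel_measurable lebesgue"
    and bound: "\<And>n. AE x in lebesgue. norm (u n x) \<le> C"
    and lim: "AE x in lebesgue. (\<lambda>n. u n x) \<longlonglongrightarrow> v x"
    and g: "g \<in> L_1"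
  shows "(\<lambda>n. pairing (u n) g) \<longlonglongrightarrow> pairing v g"
proof -
  note [measurable] = u v
  have [measurable]: "integrable lebesgue g"
    using g by (simp add: L_1_def)
  show ?thesis
  proof (rule integral_dominated_convergence)
    show "integrable lebesgue (\<lambda>x. C * norm (g x))"
      using \<open>integrable lebesgue g\<close> by (intro integrable_mult_right integrable_norm)
    show "AE x in lebesgue. (\<lambda>n. u n x \<bullet> g x) \<longlonglongrightarrow> v x \<bullet> g x"
      using lim by eventually_elim (intro tendsto_intros)
    show "AE x in lebesgue. norm (u n x \<bullet> g x) \<le> C * norm (g x)" for n
      using bound[of n]
    proof eventually_elim
      case (elim x)
      have "norm (u n x \<bullet> g x) \<le> norm (u n x) * norm (g x)"
        by (simp add: Cauchy_Schwarz_ineq2)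
      also have "\<dots> \<le> C * norm (g x)"
        using elim by (intro mult_right_mono) auto
      finally show ?case .
    qed
  qed measurable
qed

section \<open>The distributional equation as a weak* closed condition\<close>

text \<open>Up to sign this is the formal adjoint of the operator applied to a test map: the
  transposes of the \<open>A i\<close> act on the derivatives.\<close>

definition flux :: "('n::finite \<Rightarrow> real^'d^'m) \<Rightarrow> (real^'n \<Rightarrow> real^'m) \<Rightarrow> real^'n \<Rightarrow> real^'d" where
  "flux A \<phi> x = (\<Sum>i\<in>UNIV. partial i \<phi> x v* A i)"

definition fluxes :: "('n::finite \<Rightarrow> real^'d^'m) \<Rightarrow> (real^'n \<Rightarrow> real^'d) set" where
  "fluxes A = flux A ` {\<phi>. smooth \<phi> \<and> compact (closure {x. \<phi> x \<noteq> 0})}"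

text \<open>Each \<open>A i\<close> moves across the inner product. In this form the equation is a
  family of weak* tests, as soon as the fluxes are known to be integrable.\<close>

lemma distr_free_iff_pairing: "distr_free A u \<longleftrightarrow> (\<forall>g\<in>fluxes A. pairing u g = 0)"
proof -
  have "(A i *v u x) \<bullet> p = u x \<bullet> (p v* A i)" for i x p
    by (metis dot_lmul_matrix inner_commute)
  then show ?thesis
    by (auto simp: distr_free_def fluxes_def flux_def inner_sum_right)
qed

lemma continuous_on_partial:
  assumes "smooth \<phi>"
  shows "continuous_on UNIV (partial i \<phi>)"
proof -
  have "C_k (Suc 0) \<phi>"
    using assms unfolding smooth_def by blast
  then show ?thesis
    by simp
qed

lemma partial_eq_0_outside_support:
  assumes "x \<notin> closure {x. \<phi> x \<noteq> 0}"
  shows "partial i \<phi> x = 0"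
proof -
  have "((\<lambda>_. 0) has_derivative (\<lambda>_. 0)) (at x)"
    by (rule has_derivative_const)
  then have "(\<phi> has_derivative (\<lambda>_. 0)) (at x)"
    by (rule has_derivative_transform_within_open[where s = "- closure {x. \<phi> x \<noteq> 0}"])
      (use assms closure_subset[of "{x. \<phi> x \<noteq> 0}"] in auto)
  then have "frechet_derivative \<phi> (at x) = (\<lambda>_. 0)"
    by (metis frechet_derivative_at)
  then show ?thesis
    by (simp add: partial_def)
qed

text \<open>First derivatives of a test map are continuous and vanish off its compact
  support.\<close>

lemma fluxes_subset_L_1: "fluxes A \<subseteq> L_1"
proof
  fix g assume "g \<in> fluxes A"
  then obtain \<phi> where \<phi>: "smooth \<phi>" "compact (closure {x. \<phi> x \<noteq> 0})" and g: "g = flux A \<phi>"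
    by (auto simp: fluxes_def)
  let ?S = "closure {x. \<phi> x \<noteq> 0}"
  have "continuous_on ?S g"
    unfolding g flux_def transpose_matrix_vector[symmetric]
    by (intro continuous_intros continuous_on_subset[OF continuous_on_partial[OF \<phi>(1)]]
        bounded_linear.continuous_on[OF matrix_vector_mul_bounded_linear]) auto
  then have "integrable lborel (\<lambda>x. indicator ?S x *\<^sub>R g x)"
    by (rule borel_integrable_compact[OF \<phi>(2)])
  also have "(\<lambda>x. indicator ?S x *\<^sub>R g x) = g"
    by (auto simp: g flux_def indicator_def partial_eq_0_outside_support)
  finally show "g \<in> L_1"
    by (auto simp: L_1_def integrable_completion)
qed

lemma distr_free_limit:
  assumes "\<And>n. distr_free A (u n)"
    and "\<And>g. g \<in> L_1 \<Longrightarrow> (\<lambda>n. pairing (u n) g) \<longlonglongrightarrow> pairing v g"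
  shows "distr_free A v"
proof -
  have "pairing v g = 0" if g: "g \<in> fluxes A" for g
  proof -
    have "(\<lambda>n. pairing (u n) g) = (\<lambda>_. 0)"
      using assms(1) g by (auto simp: distr_free_iff_pairing)
    then show ?thesis
      using assms(2)[of g] g fluxes_subset_L_1 LIMSEQ_unique[OF _ tendsto_const] by fastforce
  qed
  then show ?thesis
    by (simp add: distr_free_iff_pairing)
qed

section \<open>Piecewise constant maps\<close>

text \<open>Up to a null set, a preimage is the union of the open pieces whose value lies in the
  given set; completeness of Lebesgue measure absorbs the rest.\<close>

lemma L_inf_piec_subset_L_inf: "L_inf_piec \<subseteq> L_inf"
proof
  fix u :: "real^'n \<Rightarrow> real^'d" assume "u \<in> L_inf_piec"
  then obtain D where bnd: "bounded (range u)"
    and D: "\<And>U. U \<in> D \<Longrightarrow> open U" "\<And>U. U \<in> D \<Longrightarrow> u constant_on U" and neg: "negligible (- \<Union>D)"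
    by (auto simp: L_inf_piec_def)
  have "u \<in> borel_measurable lebesgue"
  proof (rule measurableI)
    fix B :: "(real^'d) set"
    have "u -` B \<inter> \<Union>D = \<Union>{U\<in>D. u ` U \<subseteq> B}"
      using D(2) unfolding constant_on_def by fastforce
    moreover have "open (\<Union>{U\<in>D. u ` U \<subseteq> B})"
      using D(1) by (intro open_Union) auto
    ultimately have 1: "u -` B \<inter> \<Union>D \<in> sets lebesgue"
      by auto
    have "negligible (u -` B \<inter> - \<Union>D)"
      by (rule negligible_subset[OF neg]) auto
    then have 2: "u -` B \<inter> - \<Union>D \<in> sets lebesgue"
      using negligible_imp_sets by blast
    have "u -` B \<inter> space lebesgue = (u -` B \<inter> \<Union>D) \<union> (u -` B \<inter> - \<Union>D)"
      by auto
    then show "u -` B \<inter> space lebesgue \<in> sets lebesgue"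
      using 1 2 by (metis sets.Un)
  qed simp
  moreover have "\<exists>C. AE x in lebesgue. norm (u x) \<le> C"
    using bnd by (force simp: bounded_iff)
  ultimately show "u \<in> L_inf"
    by (simp add: L_inf_def)
qed

lemma const_in_L_inf_piec: "(\<lambda>_. c) \<in> L_inf_piec"
  unfolding L_inf_piec_def
  by (auto intro!: exI[of _ "{UNIV}"] simp: constant_on_def)

text \<open>Intersecting each \<open>U\<close> with the pieces of \<open>h U\<close> gives pieces
  for \<open>f\<close>. Boundedness is assumed separately, because infinitely many
  \<open>h U\<close> need not share a bound.\<close>

lemma L_inf_piec_glue:
  assumes bnd: "bounded (range f)" and D: "countable D" "disjoint D"
    and pieces: "\<And>U. U \<in> D \<Longrightarrow> open U" "\<And>U. U \<in> D \<Longrightarrow> h U \<in> L_inf_piec"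
      "\<And>U x. U \<in> D \<Longrightarrow> x \<in> U \<Longrightarrow> f x = h U x"
    and neg: "negligible (- \<Union>D)"
  shows "f \<in> L_inf_piec"
proof -
  have "\<forall>U\<in>D. \<exists>D'. countable D' \<and> disjoint D' \<and> (\<forall>W\<in>D'. open W \<and> h U constant_on W) \<and>
      negligible (- \<Union>D')"
    using pieces(2) by (auto simp: L_inf_piec_def)
  from bchoice[OF this] obtain P where "\<forall>U\<in>D. countable (P U) \<and> disjoint (P U) \<and>
      (\<forall>W\<in>P U. open W \<and> h U constant_on W) \<and> negligible (- \<Union>(P U))"
    ..
  then have P: "\<And>U. U \<in> D \<Longrightarrow> countable (P U)" "\<And>U. U \<in> D \<Longrightarrow> disjoint (P U)"
      "\<And>U W. U \<in> D \<Longrightarrow> W \<in> P U \<Longrightarrow> open W"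
      "\<And>U W. U \<in> D \<Longrightarrow> W \<in> P U \<Longrightarrow> h U constant_on W"
      "\<And>U. U \<in> D \<Longrightarrow> negligible (- \<Union>(P U))"
    by auto
  define Q where "Q = (\<Union>U\<in>D. (\<lambda>W. W \<inter> U) ` P U)"
  have "countable Q"
    using D(1) P(1) by (auto simp: Q_def)
  moreover have "disjoint Q"
  proof (rule disjointI)
    fix a b assume "a \<in> Q" "b \<in> Q" "a \<noteq> b"
    then obtain U V W Z where *: "U \<in> D" "V \<in> D" "W \<in> P U" "Z \<in> P V" "a = W \<inter> U" "b = Z \<inter> V"
      by (auto simp: Q_def)
    show "a \<inter> b = {}"
    proof (cases "U = V")
      case True
      then have "W \<noteq> Z"
        using * \<open>a \<noteq> b\<close> by auto
      then show ?thesis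
        using P(2)[of U] * True disjointD[of "P U" W Z] by auto
    next
      case False
      then show ?thesis
        using disjointD[OF D(2), of U V] * by auto
    qed
  qed
  moreover have "open W \<and> f constant_on W" if W: "W \<in> Q" for W
  proof -
    obtain U Z where *: "U \<in> D" "Z \<in> P U" "W = Z \<inter> U"
      using W by (auto simp: Q_def)
    obtain y where "\<And>x. x \<in> Z \<Longrightarrow> h U x = y"
      using P(4)[OF *(1,2)] by (auto simp: constant_on_def)
    then have "f constant_on W"
      using pieces(3) * by (auto simp: constant_on_def)
    then show ?thesis
      using * P(3) pieces(1) by auto
  qed
  moreover have "negligible (- \<Union>Q)"
  proof (rule negligible_subset)
    show "negligible (- \<Union>D \<union> (\<Union>U\<in>D. - \<Union>(P U)))"
      using neg P(5) D(1) by (intro negligible_Un negligible_countable_Union) auto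
    show "- \<Union>Q \<subseteq> - \<Union>D \<union> (\<Union>U\<in>D. - \<Union>(P U))"
      by (auto simp: Q_def)
  qed
  ultimately show ?thesis
    using bnd by (auto simp: L_inf_piec_def)
qed

text \<open>Continuity of measure from above: removing more and more members of \<open>D\<close>
  from \<Omega>, which has finite measure, leaves sets that decrease to a null set.\<close>

lemma finite_subcover_up_to_small_measure:
  fixes D :: "'a::euclidean_space set set"
  assumes D: "countable D" "\<And>U. U \<in> D \<Longrightarrow> open U" and neg: "negligible (- \<Union>D)"
    and \<Omega>: "\<Omega> \<in> lmeasurable" and "\<delta> > 0"
  obtains S where "finite S" "S \<subseteq> D" "emeasure lebesgue (\<Omega> - \<Union>S) < \<delta>"
proof (cases "D = {}")
  case True
  then have "negligible \<Omega>"
    using negligible_subset[OF neg, of \<Omega>] by auto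
  then have "emeasure lebesgue \<Omega> = 0"
    using negligible_iff_emeasure0 \<Omega> fmeasurableD by blast
  then show ?thesis
    using that[of "{}"] \<open>\<delta> > 0\<close> by simp
next
  case False
  \<comment> \<open>\<open>from_nat_into\<close> enumerates \<open>D\<close>, possibly with
    repetitions, when \<open>D\<close> is nonempty; hence the case distinction.\<close>
  define B where "B n = \<Omega> - \<Union>(from_nat_into D ` {..n})" for n
  have range: "range (from_nat_into D) = D"
    using False D(1) by (rule range_from_nat_into)
  have B: "B n \<in> lmeasurable" for n
  proof -
    have "open (\<Union>(from_nat_into D ` {..n}))"
      using D(2) range by (intro open_Union) auto
    then show ?thesis
      unfolding B_def using \<Omega> by (intro fmeasurable_Diff) auto
  qed
  have "(\<lambda>n. emeasure lebesgue (B n)) \<longlonglongrightarrow> emeasure lebesgue (\<Inter>n. B n)"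
  proof (rule Lim_emeasure_decseq)
    show "range B \<subseteq> sets lebesgue" "emeasure lebesgue (B n) \<noteq> \<infinity>" for n
      using B by (auto simp: fmeasurable_def top.not_eq_extremum simp del: emeasure_completion)
  qed (auto simp: B_def decseq_def)
  moreover have "negligible (\<Inter>n. B n)"
  proof (rule negligible_subset[OF neg])
    show "(\<Inter>n. B n) \<subseteq> - \<Union>D"
      by (subst range[symmetric]) (auto simp: B_def)
  qed
  then have "emeasure lebesgue (\<Inter>n. B n) = 0"
    using negligible_iff_emeasure0 negligible_imp_sets by blast
  ultimately have "\<forall>\<^sub>F n in sequentially. emeasure lebesgue (B n) < \<delta>"
    using \<open>\<delta> > 0\<close> by (simp add: order_tendstoD(2))
  then obtain n where "emeasure lebesgue (B n) < \<delta>"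
    using eventually_happens'[OF sequentially_bot] by blast
  then show ?thesis
    using that[of "from_nat_into D ` {..n}"] range by (auto simp: B_def)
qed

section \<open>Consequences of the relaxation property\<close>

text \<open>The conclusion of the relaxation property for one set and one constant. Leaving
  \<open>c\<close> arbitrary lets the notion cover also the pieces on which a map already has a
  value in \<open>E\<close>.\<close>

definition relaxing_sequence ::
  "('n::finite \<Rightarrow> real^'d^'m) \<Rightarrow> (real^'d) set \<Rightarrow> (real^'d) set \<Rightarrow> (real^'n) set \<Rightarrow> real^'d
     \<Rightarrow> (nat \<Rightarrow> real^'n \<Rightarrow> real^'d) \<Rightarrow> bool" where
  "relaxing_sequence A K E W c w \<longleftrightarrow>
     (\<forall>n. w n \<in> L_inf_piec \<and> distr_free A (w n) \<and>
        (AE x in lebesgue. x \<notin> W \<longrightarrow> w n x = c) \<and>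
        (AE x in lebesgue. x \<in> W \<longrightarrow> w n x \<in> E \<union> interior K)) \<and>
     (\<forall>g\<in>L_1. (\<lambda>n. pairing (w n) g) \<longlonglongrightarrow> pairing (\<lambda>_. c) g) \<and>
     (\<lambda>n. \<integral>\<^sup>+x\<in>W. edist_to (w n x) E \<partial>lebesgue) \<longlonglongrightarrow> 0"

locale relaxable_pair =
  fixes A :: "'n::finite \<Rightarrow> real^'d^'m" and K E :: "(real^'d) set"
  assumes relaxation: "relaxation_property A K E"
    and interior_nonempty: "interior K \<noteq> {}"
    and closed_E: "closed E" and bounded_E: "bounded E" and bounded_K: "bounded K"
begin

lemma relaxing_sequence_interior:
  assumes "bounded W" "open W" "c \<in> interior K"
  obtains w where "relaxing_sequence A K E W c w"
proof -
  obtain w where w: "\<And>n. w n \<in> L_inf_piec" "limitin weak_star w (\<lambda>_. c) sequentially"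
      "\<And>n. AE x in lebesgue. x \<notin> W \<longrightarrow> w n x = c" "\<And>n. distr_free A (w n)"
      "\<And>n. AE x in lebesgue. x \<in> W \<longrightarrow> w n x \<in> E \<union> interior K"
      "(\<lambda>n. \<integral>\<^sup>+x\<in>W. edist_to (w n x) E \<partial>lebesgue) \<longlonglongrightarrow> 0"
    using relaxation[unfolded relaxation_property_def, rule_format, of W c] assms by blast
  have "\<forall>g\<in>L_1. (\<lambda>n. pairing (w n) g) \<longlonglongrightarrow> pairing (\<lambda>_. c) g"
    using limitin_weak_star[of w "\<lambda>_. c"] w(1,2) L_inf_piec_subset_L_inf const_in_L_inf by blast
  then show ?thesis
    using that[of w] w by (auto simp: relaxing_sequence_def)
qed

text \<open>Otherwise the distance is infinite, and integrals over a ball that all equal infinity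
  cannot tend to 0.\<close>

lemma E_nonempty: "E \<noteq> {}"
proof
  assume "E = {}"
  obtain c where "c \<in> interior K"
    using interior_nonempty by blast
  then obtain w where w: "relaxing_sequence A K E (ball (0::real^'n) 1) c w"
    using relaxing_sequence_interior[OF bounded_ball open_ball] by blast
  have "emeasure lebesgue (ball (0::real^'n) 1) \<noteq> 0"
    using open_not_negligible[of "ball (0::real^'n) 1"] negligible_iff_emeasure0[of "ball (0::real^'n) 1"]
    by auto
  then have "(\<integral>\<^sup>+x\<in>ball (0::real^'n) 1. edist_to (w n x) E \<partial>lebesgue) = \<infinity>" for n
    using \<open>E = {}\<close> nn_integral_cmult_indicator[of "ball (0::real^'n) 1" lebesgue "\<infinity>"]
    by (simp add: edist_to_def ennreal_top_mult)
  then show False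
    using w LIMSEQ_unique[OF tendsto_const, of "\<infinity>::ennreal" 0] by (simp add: relaxing_sequence_def)
qed

text \<open>Constants in \<open>interior K\<close> are weak* limits of \<open>\<A>\<close>-free maps, and they span all
  constants; this avoids integrating the derivatives of test functions.\<close>

lemma distr_free_const: "distr_free A (\<lambda>_. c)"
proof -
  have interior: "distr_free A (\<lambda>_. b)" if b: "b \<in> interior K" for b
  proof -
    obtain w where w: "relaxing_sequence A K E (ball (0::real^'n) 1) b w"
      using relaxing_sequence_interior[OF bounded_ball open_ball b] by blast
    show ?thesis
      by (rule distr_free_limit[of A w]) (use w in \<open>auto simp: relaxing_sequence_def\<close>)
  qed
  obtain a r where a: "r > 0" "cball a r \<subseteq> interior K"
    using interior_nonempty open_contains_cball[of "interior K"] open_interior[of K] by blast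
  \<comment> \<open>This \<open>s\<close> keeps \<open>b\<close> within distance \<open>r\<close> of
    \<open>a\<close>, and \<open>c\<close> is recovered as a multiple of \<open>b - a\<close>. The
    added 1 avoids a division by zero when \<open>c\<close> is zero.\<close>
  define s where "s = r / (norm c + 1)"
  define b where "b = a + s *\<^sub>R c"
  have "s > 0"
    using a(1) by (simp add: s_def add_nonneg_pos)
  have "s * norm c \<le> s * (norm c + 1)"
    using \<open>s > 0\<close> by simp
  also have "\<dots> = r"
    using norm_ge_zero[of c] by (simp add: s_def add_nonneg_eq_0_iff)
  finally have "b \<in> cball a r" "a \<in> cball a r"
    using a(1) \<open>s > 0\<close> by (simp_all add: b_def dist_norm)
  then have "a \<in> interior K" "b \<in> interior K"
    using a(2) by blast+
  then have *: "pairing (\<lambda>_. a) g = 0" "pairing (\<lambda>_. b) g = 0" if "g \<in> fluxes A" for g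
    using interior that by (auto simp: distr_free_iff_pairing)
  have "pairing (\<lambda>_. c) g = 0" if g: "g \<in> fluxes A" for g
  proof -
    have "g \<in> L_1"
      using g fluxes_subset_L_1 by blast
    have "pairing (\<lambda>_. c) g = (LINT x|lebesgue. inverse s * (b \<bullet> g x - a \<bullet> g x))"
      using \<open>s > 0\<close> by (simp add: b_def inner_add_left)
    also have "\<dots> = inverse s * (pairing (\<lambda>_. b) g - pairing (\<lambda>_. a) g)"
      using \<open>g \<in> L_1\<close> by (simp add: integrable_inner_L_inf_L_1 const_in_L_inf)
    finally show ?thesis
      using * g by simp
  qed
  then show ?thesis
    by (simp add: distr_free_iff_pairing)
qed

text \<open>If \<open>c\<close> is not in \<open>interior K\<close>, then it lies in
  \<open>E\<close> or \<open>W\<close> is empty; in both cases the constant sequence works, with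
  distance integrals equal to 0.\<close>

lemma relaxing_sequence_exists:
  assumes "bounded W" "open W" and c: "W \<noteq> {} \<Longrightarrow> c \<in> E \<union> interior K"
  shows "\<exists>w. relaxing_sequence A K E W c w"
proof (cases "c \<in> interior K")
  case True
  then show ?thesis
    using relaxing_sequence_interior assms by blast
next
  case False
  have *: "edist_to c E * indicator W x = 0" for x :: "real^'n"
  proof (cases "x \<in> W")
    case True
    then have "c \<in> E"
      using c False by auto
    then show ?thesis
      using edist_to_infdist[OF E_nonempty, of c] by simp
  qed simp
  have "AE x in lebesgue. x \<in> W \<longrightarrow> c \<in> E \<union> interior K"
    by (rule AE_I2) (use c in auto)
  then have "relaxing_sequence A K E W c (\<lambda>_ _. c)"
    unfolding relaxing_sequence_def * using distr_free_const const_in_L_inf_piec by simp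
  then show ?thesis
    by blast
qed

text \<open>A condition that holds almost everywhere on a nonempty open set holds at some point of
  it, and there is only one value to test.\<close>

lemma pieces_in_target:
  assumes "open \<Omega>" "open U" "\<And>x. x \<in> U \<Longrightarrow> u x = c" "U \<inter> \<Omega> \<noteq> {}"
    and "AE x in lebesgue. x \<in> \<Omega> \<longrightarrow> u x \<in> E \<union> interior K"
  shows "c \<in> E \<union> interior K"
proof (rule ccontr)
  assume "c \<notin> E \<union> interior K"
  have "AE x in lebesgue. x \<notin> U \<inter> \<Omega>"
    using assms(5) by eventually_elim (use assms(3) \<open>c \<notin> _\<close> in auto)
  then have "negligible (U \<inter> \<Omega>)"
    by (simp add: AE_iff_null_sets negligible_iff_null_sets assms(1,2) open_Int)
  then show False
    using open_not_negligible assms by blast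
qed

lemma edist_to_measurable [measurable]: "(\<lambda>y. edist_to y E) \<in> borel_measurable borel"
  unfolding edist_to_infdist[OF E_nonempty]
  by (intro measurable_compose[OF _ measurable_ennreal] borel_measurable_continuous_onI continuous_intros)

text \<open>Any point of \<open>E\<close> is within \<open>2 * M\<close> of every admissible value.
  This pays for the part of \<Omega> on which a map is left unchanged.\<close>

lemma target_bounded:
  obtains M where "M > 0" "\<And>y. y \<in> E \<union> interior K \<Longrightarrow> norm y \<le> M"
    "\<And>y. y \<in> E \<union> interior K \<Longrightarrow> edist_to y E \<le> ennreal (2 * M)"
proof -
  have "bounded (E \<union> interior K)"
    using bounded_E bounded_K bounded_subset interior_subset by auto
  then obtain M where M: "M > 0" "\<And>y. y \<in> E \<union> interior K \<Longrightarrow> norm y \<le> M"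
    unfolding bounded_pos by blast
  obtain e where e: "e \<in> E"
    using E_nonempty by blast
  have "edist_to y E \<le> ennreal (2 * M)" if "y \<in> E \<union> interior K" for y
  proof -
    have "dist y e \<le> norm y + norm e"
      by (simp add: dist_norm norm_triangle_ineq4)
    also have "\<dots> \<le> 2 * M"
      using M(2)[OF that] M(2)[of e] e by simp
    finally have "infdist y E \<le> 2 * M"
      using infdist_le[OF e, of y] by simp
    then show ?thesis
      by (simp add: edist_to_infdist[OF E_nonempty] ennreal_leI)
  qed
  then show ?thesis
    using that M by blast
qed

section \<open>Approximation inside \<open>V_set\<close> with small distance to
  \<open>E\<close>\<close>

text \<open>Since only finitely many pieces are modified, their limits can be taken inside finite
  sums, and a single index meets all requirements.\<close>

lemma V_set_approximation:
  assumes \<Omega>: "bounded \<Omega>" "open \<Omega>" and u: "u \<in> V_set A \<Omega> E K \<xi>"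
    and G: "finite G" "G \<subseteq> L_1" and "\<epsilon> > 0"
  obtains v where "v \<in> V_set A \<Omega> E K \<xi>" "\<And>g. g \<in> G \<Longrightarrow> \<bar>pairing v g - pairing u g\<bar> < \<epsilon>"
    "(\<integral>\<^sup>+x\<in>\<Omega>. edist_to (v x) E \<partial>lebesgue) < ennreal \<epsilon>"
proof -
  have u_free: "distr_free A u" and u_out: "AE x in lebesgue. x \<notin> \<Omega> \<longrightarrow> u x = \<xi>"
    and u_in: "AE x in lebesgue. x \<in> \<Omega> \<longrightarrow> u x \<in> E \<union> interior K"
    and u_piec: "u \<in> L_inf_piec"
    using u by (auto simp: V_set_def)
  then obtain D where u_bnd: "bounded (range u)" and D: "countable D" "disjoint D"
    "\<And>U. U \<in> D \<Longrightarrow> open U" "\<And>U. U \<in> D \<Longrightarrow> u constant_on U" and neg: "negligible (- \<Union>D)"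
    by (auto simp: L_inf_piec_def)
  have "\<forall>U\<in>D. \<exists>c. \<forall>x\<in>U. u x = c"
    using D(4) by (auto simp: constant_on_def)
  from bchoice[OF this] obtain c where c: "\<And>U x. U \<in> D \<Longrightarrow> x \<in> U \<Longrightarrow> u x = c U"
    by auto
  \<comment> \<open>Pieces that miss \<Omega> are included: nothing is asked of the constant when
    the set is empty.\<close>
  have "\<forall>U\<in>D. \<exists>w. relaxing_sequence A K E (U \<inter> \<Omega>) (c U) w"
  proof
    fix U assume "U \<in> D"
    show "\<exists>w. relaxing_sequence A K E (U \<inter> \<Omega>) (c U) w"
    proof (rule relaxing_sequence_exists)
      show "c U \<in> E \<union> interior K" if "U \<inter> \<Omega> \<noteq> {}"
        using pieces_in_target[OF \<Omega>(2) D(3) c that u_in] \<open>U \<in> D\<close> by blast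
    qed (use \<Omega> D(3) \<open>U \<in> D\<close> in auto)
  qed
  from bchoice[OF this] obtain w where "\<forall>U\<in>D. relaxing_sequence A K E (U \<inter> \<Omega>) (c U) (w U)"
    ..
  then have w: "\<And>U n. U \<in> D \<Longrightarrow> w U n \<in> L_inf_piec" "\<And>U n. U \<in> D \<Longrightarrow> distr_free A (w U n)"
      "\<And>U n. U \<in> D \<Longrightarrow> AE x in lebesgue. x \<notin> U \<inter> \<Omega> \<longrightarrow> w U n x = c U"
      "\<And>U n. U \<in> D \<Longrightarrow> AE x in lebesgue. x \<in> U \<inter> \<Omega> \<longrightarrow> w U n x \<in> E \<union> interior K"
      "\<And>U g. U \<in> D \<Longrightarrow> g \<in> L_1 \<Longrightarrow> (\<lambda>n. pairing (w U n) g) \<longlonglongrightarrow> pairing (\<lambda>_. c U) g"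
      "\<And>U. U \<in> D \<Longrightarrow> (\<lambda>n. \<integral>\<^sup>+x\<in>U \<inter> \<Omega>. edist_to (w U n x) E \<partial>lebesgue) \<longlonglongrightarrow> 0"
    unfolding relaxing_sequence_def by blast+
  obtain M where M: "M > 0" "\<And>y. y \<in> E \<union> interior K \<Longrightarrow> edist_to y E \<le> ennreal (2 * M)"
    using target_bounded by metis
  \<comment> \<open>The unchanged part then costs at most \<open>\<epsilon> / 2\<close>, strictly
    below \<epsilon>, which leaves room for the terms that tend to 0.\<close>
  define \<delta> where "\<delta> = \<epsilon> / (4 * M)"
  have "\<delta> > 0"
    using M(1) \<open>\<epsilon> > 0\<close> by (simp add: \<delta>_def)
  have \<Omega>_meas: "\<Omega> \<in> lmeasurable"
    using \<Omega> by (rule lmeasurable_open)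
  obtain S where S: "finite S" "S \<subseteq> D" "emeasure lebesgue (\<Omega> - \<Union>S) < ennreal \<delta>"
    using finite_subcover_up_to_small_measure[OF D(1,3) neg \<Omega>_meas, of "ennreal \<delta>"] \<open>\<delta> > 0\<close>
    by (metis ennreal_less_zero_iff)
  have [measurable]: "\<Omega> \<in> sets lebesgue" "\<Omega> - \<Union>S \<in> sets lebesgue"
      "U \<in> S \<Longrightarrow> U \<inter> \<Omega> \<in> sets lebesgue" for U
  proof -
    have "open (\<Union>S)"
      using S D(3) by (intro open_Union) auto
    then show "\<Omega> \<in> sets lebesgue" "\<Omega> - \<Union>S \<in> sets lebesgue"
      using \<Omega> by auto
    show "U \<inter> \<Omega> \<in> sets lebesgue" if "U \<in> S"
      using that S D(3)[of U] \<Omega> by auto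
  qed
  \<comment> \<open>By disjointness at most one summand is nonzero. A sum, rather than a definition
    by cases, prepares the linear computation of pairings.\<close>
  define v where "v n x = u x + (\<Sum>U\<in>S. indicator U x *\<^sub>R (w U n x - u x))" for n x
  have v_in: "v n x = w U n x" if U: "U \<in> S" "x \<in> U" for n U x
  proof -
    have "indicator U' x = (0::real)" if "U' \<in> S - {U}" for U'
      using disjointD[OF D(2), of U U'] that U S by (auto simp: indicator_def)
    then have "(\<Sum>U\<in>S. indicator U x *\<^sub>R (w U n x - u x)) = indicator U x *\<^sub>R (w U n x - u x)"
      by (subst sum.remove[OF S(1) U(1)]) simp
    then show ?thesis
      using U by (simp add: v_def)
  qed
  have v_out: "v n x = u x" if "x \<notin> \<Union>S" for n x
  proof -
    have "(\<Sum>U\<in>S. indicator U x *\<^sub>R (w U n x - u x)) = 0"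
      using that by (intro sum.neutral) auto
    then show ?thesis
      by (simp add: v_def)
  qed
  \<comment> \<open>Since \<open>w U n\<close> equals \<open>c U\<close> almost everywhere off
    \<open>U \<inter> \<Omega>\<close>, the indicators disappear. Each correction is a difference of
    free maps on the whole space, so no interface terms arise.\<close>
  have v_AE: "AE x in lebesgue. v n x = u x + (\<Sum>U\<in>S. w U n x - c U)" for n
  proof -
    have "AE x in lebesgue. \<forall>U\<in>S. x \<notin> U \<inter> \<Omega> \<longrightarrow> w U n x = c U"
      by (rule AE_finite_allI[OF S(1)]) (use w(3) S in auto)
    then show ?thesis
    proof eventually_elim
      case (elim x)
      have "indicator U x *\<^sub>R (w U n x - u x) = w U n x - c U" if "U \<in> S" for U
        using elim c[of U x] that S by (cases "x \<in> U") auto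
      then show ?case
        by (simp add: v_def)
    qed
  qed
  have v_piec: "v n \<in> L_inf_piec" for n
  proof (rule L_inf_piec_glue[OF _ D(1,2,3) _ _ neg, where h = "\<lambda>U. if U \<in> S then w U n else u"])
    have "range (v n) \<subseteq> range u \<union> (\<Union>U\<in>S. range (w U n))"
      using v_in v_out by fastforce
    moreover have "bounded (range u \<union> (\<Union>U\<in>S. range (w U n)))"
      using u_bnd S w(1) by (auto simp: L_inf_piec_def intro!: bounded_UN)
    ultimately show "bounded (range (v n))"
      using bounded_subset by blast
    show "v n x = (if U \<in> S then w U n else u) x" if "U \<in> D" "x \<in> U" for U x
    proof (cases "U \<in> S")
      case False
      then have "x \<notin> \<Union>S"
        using that S disjointD[OF D(2), of U] by auto
      then show ?thesis
        using v_out False by simp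
    qed (use v_in that in auto)
  qed (use w(1) u_piec in auto)
  \<comment> \<open>This identity serves twice: with tests in \<open>fluxes A\<close> it shows that
    \<open>v n\<close> is free, and with tests in \<open>G\<close> that it approaches
    \<open>u\<close>.\<close>
  have pairing_v: "pairing (v n) g = pairing u g + (\<Sum>U\<in>S. pairing (w U n) g - pairing (\<lambda>_. c U) g)"
    if g: "g \<in> L_1" for n g
  proof -
    have w_L: "w U n \<in> L_inf" if "U \<in> S" for U
      using that S w(1) L_inf_piec_subset_L_inf by blast
    have u_L: "u \<in> L_inf" and v_L: "v n \<in> L_inf"
      using u_piec v_piec L_inf_piec_subset_L_inf by blast+
    have int: "integrable lebesgue (\<lambda>x. u x \<bullet> g x)" "integrable lebesgue (\<lambda>x. v n x \<bullet> g x)"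
        "integrable lebesgue (\<lambda>x. c U \<bullet> g x)" for U
      using u_L v_L g by (auto intro!: integrable_inner_L_inf_L_1 const_in_L_inf)
    have int_w: "integrable lebesgue (\<lambda>x. w U n x \<bullet> g x)" if "U \<in> S" for U
      using w_L[OF that] g by (rule integrable_inner_L_inf_L_1)
    have int_sum: "integrable lebesgue (\<lambda>x. \<Sum>U\<in>S. w U n x \<bullet> g x - c U \<bullet> g x)"
      by (intro Bochner_Integration.integrable_sum Bochner_Integration.integrable_diff int int_w)
    have "pairing (v n) g =
        (LINT x|lebesgue. u x \<bullet> g x + (\<Sum>U\<in>S. w U n x \<bullet> g x - c U \<bullet> g x))"
    proof (rule integral_cong_AE)
      show "AE x in lebesgue. v n x \<bullet> g x = u x \<bullet> g x + (\<Sum>U\<in>S. w U n x \<bullet> g x - c U \<bullet> g x)"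
        using v_AE[of n]
        by eventually_elim (simp add: inner_add_left inner_sum_left inner_diff_left)
    qed (use int int_sum in auto)
    also have "\<dots> = pairing u g + (LINT x|lebesgue. (\<Sum>U\<in>S. w U n x \<bullet> g x - c U \<bullet> g x))"
      by (rule Bochner_Integration.integral_add[OF int(1) int_sum])
    also have "(LINT x|lebesgue. (\<Sum>U\<in>S. w U n x \<bullet> g x - c U \<bullet> g x)) =
        (\<Sum>U\<in>S. pairing (w U n) g - pairing (\<lambda>_. c U) g)"
      using int int_w by (subst Bochner_Integration.integral_sum)
        (auto intro!: sum.cong Bochner_Integration.integral_diff Bochner_Integration.integrable_diff)
    finally show ?thesis .
  qed
  have v_V: "v n \<in> V_set A \<Omega> E K \<xi>" for n
  proof -
    have "pairing (v n) g = 0" if g: "g \<in> fluxes A" for g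
    proof -
      have "pairing (\<lambda>_. c U) g = 0" "pairing u g = 0" for U
        using distr_free_const u_free g by (auto simp: distr_free_iff_pairing)
      moreover have "pairing (w U n) g = 0" if "U \<in> S" for U
        using w(2) S g that by (auto simp: distr_free_iff_pairing)
      ultimately show ?thesis
        using pairing_v[of g n] g fluxes_subset_L_1 by auto
    qed
    then have "distr_free A (v n)"
      by (simp add: distr_free_iff_pairing)
    moreover have "AE x in lebesgue. \<forall>U\<in>S. x \<notin> U \<inter> \<Omega> \<longrightarrow> w U n x = c U"
      by (rule AE_finite_allI[OF S(1)]) (use w(3) S in auto)
    with u_out have "AE x in lebesgue. x \<notin> \<Omega> \<longrightarrow> v n x = \<xi>"
    proof eventually_elim
      case (elim x)
      show ?case
      proof (cases "x \<in> \<Union>S")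
        case True
        then obtain U where "U \<in> S" "x \<in> U"
          by blast
        then show ?thesis
          using elim v_in[of U x n] c[of U x] S by auto
      qed (use elim v_out in auto)
    qed
    moreover have "AE x in lebesgue. \<forall>U\<in>S. x \<in> U \<inter> \<Omega> \<longrightarrow> w U n x \<in> E \<union> interior K"
      by (rule AE_finite_allI[OF S(1)]) (use w(4) S in blast)
    with u_in have "AE x in lebesgue. x \<in> \<Omega> \<longrightarrow> v n x \<in> E \<union> interior K"
    proof eventually_elim
      case (elim x)
      show ?case
      proof (cases "x \<in> \<Union>S")
        case True
        then obtain U where "U \<in> S" "x \<in> U"
          by blast
        then show ?thesis
          using elim v_in[of U x n] by auto
      qed (use elim v_out in auto)
    qed
    ultimately show ?thesis
      using v_piec by (simp add: V_set_def)
  qed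
  have [measurable]: "w U n \<in> borel_measurable lebesgue" if "U \<in> S" for U n
    using that S w(1) L_inf_piec_subset_L_inf unfolding L_inf_def by blast
  \<comment> \<open>On a chosen piece the distance is that of \<open>w U n\<close>; on the rest of
    \<Omega> the map is \<open>u\<close>, and the crude bound \<open>2 * M\<close> applies.\<close>
  have edist_v: "(\<integral>\<^sup>+x\<in>\<Omega>. edist_to (v n x) E \<partial>lebesgue) \<le>
      (\<Sum>U\<in>S. \<integral>\<^sup>+x\<in>U \<inter> \<Omega>. edist_to (w U n x) E \<partial>lebesgue) +
      ennreal (2 * M) * emeasure lebesgue (\<Omega> - \<Union>S)" for n
  proof -
    have "(\<integral>\<^sup>+x\<in>\<Omega>. edist_to (v n x) E \<partial>lebesgue) \<le>
        (\<integral>\<^sup>+x. (\<Sum>U\<in>S. edist_to (w U n x) E * indicator (U \<inter> \<Omega>) x) +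
          ennreal (2 * M) * indicator (\<Omega> - \<Union>S) x \<partial>lebesgue)"
    proof (rule nn_integral_mono_AE)
      show "AE x in lebesgue. edist_to (v n x) E * indicator \<Omega> x \<le>
          (\<Sum>U\<in>S. edist_to (w U n x) E * indicator (U \<inter> \<Omega>) x) +
          ennreal (2 * M) * indicator (\<Omega> - \<Union>S) x"
        using u_in
      proof eventually_elim
        case (elim x)
        consider "x \<notin> \<Omega>" | U where "U \<in> S" "x \<in> U" "x \<in> \<Omega>" | "x \<in> \<Omega> - \<Union>S"
          by blast
        then show ?case
        proof cases
          case 2
          have "edist_to (v n x) E * indicator \<Omega> x = edist_to (w U n x) E * indicator (U \<inter> \<Omega>) x"
            using 2 v_in by simp
          also have "\<dots> \<le> (\<Sum>U\<in>S. edist_to (w U n x) E * indicator (U \<inter> \<Omega>) x)"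
            by (rule member_le_sum) (use 2 S in auto)
          finally show ?thesis
            by (rule order_trans) simp
        next
          case 3
          then show ?thesis
            using elim M(2) v_out by (auto intro: add_increasing)
        qed simp
      qed
    qed
    also have "\<dots> = (\<Sum>U\<in>S. \<integral>\<^sup>+x\<in>U \<inter> \<Omega>. edist_to (w U n x) E \<partial>lebesgue) +
        ennreal (2 * M) * emeasure lebesgue (\<Omega> - \<Union>S)"
      by (subst nn_integral_add, measurable, subst nn_integral_sum, measurable)
        (simp del: emeasure_completion add: nn_integral_cmult_indicator)
    finally show ?thesis .
  qed
  have "(\<lambda>n. (\<Sum>U\<in>S. \<integral>\<^sup>+x\<in>U \<inter> \<Omega>. edist_to (w U n x) E \<partial>lebesgue) +
      ennreal (2 * M) * emeasure lebesgue (\<Omega> - \<Union>S)) \<longlonglongrightarrow>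
      (\<Sum>U\<in>S. 0) + ennreal (2 * M) * emeasure lebesgue (\<Omega> - \<Union>S)"
    using w(6) S by (intro tendsto_intros) auto
  moreover have "ennreal (2 * M) * emeasure lebesgue (\<Omega> - \<Union>S) < ennreal \<epsilon>"
  proof -
    have "ennreal (2 * M) * emeasure lebesgue (\<Omega> - \<Union>S) \<le> ennreal (2 * M) * ennreal \<delta>"
      using S(3) by (intro mult_left_mono) auto
    also have "\<dots> = ennreal (\<epsilon> / 2)"
      using M(1) \<open>\<delta> > 0\<close> by (simp add: ennreal_mult[symmetric] \<delta>_def)
    also have "\<dots> < ennreal \<epsilon>"
      using \<open>\<epsilon> > 0\<close> by (simp add: ennreal_less_iff)
    finally show ?thesis .
  qed
  ultimately have "\<forall>\<^sub>F n in sequentially. (\<Sum>U\<in>S. \<integral>\<^sup>+x\<in>U \<inter> \<Omega>. edist_to (w U n x) E \<partial>lebesgue) +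
      ennreal (2 * M) * emeasure lebesgue (\<Omega> - \<Union>S) < ennreal \<epsilon>"
    by (intro order_tendstoD(2)) auto
  moreover have "\<forall>\<^sub>F n in sequentially. \<forall>g\<in>G. \<bar>pairing (v n) g - pairing u g\<bar> < \<epsilon>"
  proof (rule eventually_ball_finite[OF G(1)], rule ballI)
    fix g assume "g \<in> G"
    then have g: "g \<in> L_1"
      using G by blast
    have "(\<lambda>n. pairing (v n) g) \<longlonglongrightarrow>
        pairing u g + (\<Sum>U\<in>S. pairing (\<lambda>_. c U) g - pairing (\<lambda>_. c U) g)"
      unfolding pairing_v[OF g] using w(5) S g by (intro tendsto_intros) auto
    then have "(\<lambda>n. pairing (v n) g) \<longlonglongrightarrow> pairing u g"
      by simp
    then show "\<forall>\<^sub>F n in sequentially. \<bar>pairing (v n) g - pairing u g\<bar> < \<epsilon>"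
      by (auto dest!: tendstoD[OF _ \<open>\<epsilon> > 0\<close>] simp: dist_real_def)
  qed
  ultimately have "\<forall>\<^sub>F n in sequentially. (\<integral>\<^sup>+x\<in>\<Omega>. edist_to (v n x) E \<partial>lebesgue) < ennreal \<epsilon> \<and>
      (\<forall>g\<in>G. \<bar>pairing (v n) g - pairing u g\<bar> < \<epsilon>)"
    by eventually_elim (use edist_v order_le_less_trans in blast)
  then obtain n where "(\<integral>\<^sup>+x\<in>\<Omega>. edist_to (v n x) E \<partial>lebesgue) < ennreal \<epsilon>"
      "\<forall>g\<in>G. \<bar>pairing (v n) g - pairing u g\<bar> < \<epsilon>"
    using eventually_happens'[OF sequentially_bot] by fast
  then show ?thesis
    using that v_V by blast
qed

section \<open>Strong convergence to an exact solution\<close>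

text \<open>The neighbourhood is arbitrary so that one construction gives both existence, with
  \<open>T\<close> the whole space, and density.\<close>

lemma exact_solution_near:
  fixes T :: "(real^'n \<Rightarrow> real^'d) set"
  assumes \<Omega>: "bounded \<Omega>" "open \<Omega>" and u0: "u0 \<in> V_set A \<Omega> E K \<xi>"
    and T: "openin weak_star T" "u0 \<in> T"
  obtains u where "u \<in> T" "u \<in> L_inf" "distr_free A u"
    "AE x in lebesgue. x \<in> \<Omega> \<longrightarrow> u x \<in> E" "AE x in lebesgue. x \<notin> \<Omega> \<longrightarrow> u x = \<xi>"
    "u \<in> weak_star closure_of V_set A \<Omega> E K \<xi>"
proof -
  let ?V = "V_set A \<Omega> E K \<xi>"
  \<comment> \<open>Maps in \<open>V_set\<close> agree almost everywhere off \<Omega>, so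
    differences lose nothing by this truncation.\<close>
  define cut where "cut v x = indicator \<Omega> x *\<^sub>R v x" for v :: "real^'n \<Rightarrow> real^'d" and x
  have \<Omega>_meas: "\<Omega> \<in> lmeasurable"
    using \<Omega> by (rule lmeasurable_open)
  then have [measurable]: "\<Omega> \<in> sets lebesgue"
    by blast
  obtain M where M: "M > 0" "\<And>y. y \<in> E \<union> interior K \<Longrightarrow> norm y \<le> M"
    using target_bounded by metis
  define C where "C = M + norm \<xi>"
  have V_L_inf: "v \<in> L_inf" if "v \<in> ?V" for v
    using that L_inf_piec_subset_L_inf by (auto simp: V_set_def)
  have V_meas: "v \<in> borel_measurable lebesgue" if "v \<in> ?V" for v
    using V_L_inf[OF that] by (simp add: L_inf_def)
  have V_bound: "AE x in lebesgue. norm (v x) \<le> C" if "v \<in> ?V" for v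
  proof -
    have "AE x in lebesgue. x \<notin> \<Omega> \<longrightarrow> v x = \<xi>" "AE x in lebesgue. x \<in> \<Omega> \<longrightarrow> v x \<in> E \<union> interior K"
      using that by (auto simp: V_set_def)
    then show ?thesis
    proof eventually_elim
      case (elim x)
      then show ?case
      proof (cases "x \<in> \<Omega>")
        case True
        then have "norm (v x) \<le> M"
          using elim M(2) by blast
        then show ?thesis
          using norm_ge_zero[of \<xi>] unfolding C_def by linarith
      qed (use elim M(1) in \<open>simp add: C_def\<close>)
    qed
  qed
  have cut_L_1: "cut v \<in> L_1" if v: "v \<in> ?V" for v
  proof -
    have [measurable]: "v \<in> borel_measurable lebesgue"
      using V_meas[OF v] .
    have "integrable lebesgue (cut v)"
    proof (rule Bochner_Integration.integrable_bound)
      show "integrable lebesgue (\<lambda>x. C * indicator \<Omega> x)"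
        using \<Omega>_meas by (intro integrable_mult_right integrable_real_indicator) (auto simp: fmeasurable_def)
      show "AE x in lebesgue. norm (cut v x) \<le> norm (C * indicator \<Omega> x)"
        using V_bound[OF v] by eventually_elim (auto simp: cut_def indicator_def)
    qed (unfold cut_def, measurable)
    then show ?thesis
      by (simp add: L_1_def)
  qed
  obtain G0 e where G0: "finite G0" "G0 \<subseteq> L_1" "e > 0"
    "\<forall>u\<in>L_inf. (\<forall>g\<in>G0. \<bar>pairing u g - pairing u0 g\<bar> < e) \<longrightarrow> u \<in> T"
    using weak_star_nhd[OF T] by blast
  \<comment> \<open>All steps together will change a pairing by at most \<open>2 * \<delta>\<close>,
    which is below \<open>e\<close>. The bound by 1 lets the distance estimate drop the factor
    \<delta>.\<close>
  define \<delta> where "\<delta> = min (e / 4) 1"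
  have \<delta>: "\<delta> > 0" "\<delta> \<le> 1" "2 * \<delta> < e"
    using G0(3) by (auto simp: \<delta>_def)
  \<comment> \<open>A state is a map with the finite set of tests collected so far; the clause for
    index 0 fixes the starting map.\<close>
  define P where "P n z \<longleftrightarrow> (n = 0 \<longrightarrow> fst z = u0) \<and> fst z \<in> ?V \<and> finite (snd z) \<and> snd z \<subseteq> L_1 \<and>
      G0 \<subseteq> snd z \<and> cut (fst z) \<in> snd z" for n :: nat and z
  \<comment> \<open>Tests are never discarded, so every later step still controls the pairings with
    all earlier cuts.\<close>
  define Q where "Q n z z' \<longleftrightarrow> snd z \<subseteq> snd z' \<and>
      (\<forall>g\<in>snd z. \<bar>pairing (fst z') g - pairing (fst z) g\<bar> < \<delta> * (1/2) ^ n) \<and>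
      (\<integral>\<^sup>+x\<in>\<Omega>. edist_to (fst z' x) E \<partial>lebesgue) < ennreal ((1/2) ^ n)" for n and
      z z' :: "(real^'n \<Rightarrow> real^'d) \<times> (real^'n \<Rightarrow> real^'d) set"
  have "\<exists>f. \<forall>n. P n (f n) \<and> Q n (f n) (f (Suc n))"
  proof (rule dependent_nat_choice)
    show "\<exists>z. P 0 z"
      using u0 G0 cut_L_1[OF u0] by (intro exI[of _ "(u0, insert (cut u0) G0)"]) (auto simp: P_def)
    fix z n assume z: "P n z"
    then have z_V: "fst z \<in> ?V" and z_G: "finite (snd z)" "snd z \<subseteq> L_1" "G0 \<subseteq> snd z"
      by (auto simp: P_def)
    have pos: "\<delta> * (1/2) ^ n > 0"
      using \<delta>(1) by simp
    obtain v where v: "v \<in> ?V"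
        "\<And>g. g \<in> snd z \<Longrightarrow> \<bar>pairing v g - pairing (fst z) g\<bar> < \<delta> * (1/2) ^ n"
        "(\<integral>\<^sup>+x\<in>\<Omega>. edist_to (v x) E \<partial>lebesgue) < ennreal (\<delta> * (1/2) ^ n)"
      using V_set_approximation[OF \<Omega> z_V z_G(1,2) pos] by blast
    have "\<delta> * (1/2) ^ n \<le> (1/2) ^ n"
      using \<delta> by (simp add: mult_left_le_one_le)
    then have "(\<integral>\<^sup>+x\<in>\<Omega>. edist_to (v x) E \<partial>lebesgue) < ennreal ((1/2) ^ n)"
      using v(3) ennreal_leI order_less_le_trans by blast
    then show "\<exists>z'. P (Suc n) z' \<and> Q n z z'"
      using v z_G cut_L_1[OF v(1)]
      by (intro exI[of _ "(v, insert (cut v) (snd z))"]) (simp add: P_def Q_def subset_insertI2 subset_insertI)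
  qed
  then obtain f where f: "\<And>n. P n (f n)" "\<And>n. Q n (f n) (f (Suc n))"
    by blast
  define u where "u n = fst (f n)" for n
  define G where "G n = snd (f n)" for n
  have u: "u 0 = u0" "\<And>n. u n \<in> ?V" and G: "\<And>n. G n \<subseteq> L_1" "\<And>n. G0 \<subseteq> G n" "\<And>n. cut (u n) \<in> G n"
    using f(1) by (auto simp: P_def u_def G_def)
  have step: "\<And>n. G n \<subseteq> G (Suc n)"
      "\<And>n g. g \<in> G n \<Longrightarrow> \<bar>pairing (u (Suc n)) g - pairing (u n) g\<bar> < \<delta> * (1/2) ^ n"
      "\<And>n. (\<integral>\<^sup>+x\<in>\<Omega>. edist_to (u (Suc n) x) E \<partial>lebesgue) < ennreal ((1/2) ^ n)"
    using f(2) by (auto simp: Q_def u_def G_def)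
  note [measurable] = V_meas[OF u(2)]
  have G_mono: "G k \<subseteq> G m" if "k \<le> m" for k m
    using lift_Suc_mono_le[of G, OF step(1) that] .
  \<comment> \<open>The geometric bounds telescope. The subtracted term at \<open>m\<close> is kept
    because the monotonicity of \<open>b\<close> depends on it.\<close>
  have drift: "\<bar>pairing (u m) g - pairing (u k) g\<bar> \<le> 2 * \<delta> * (1/2) ^ k - 2 * \<delta> * (1/2) ^ m"
    if "k \<le> m" and g: "g \<in> G k" for k m g
    using \<open>k \<le> m\<close>
  proof (induction m rule: dec_induct)
    case (step m)
    have "g \<in> G m"
      using G_mono step(1) g by blast
    then show ?case
      using \<open>\<And>n g. g \<in> G n \<Longrightarrow> \<bar>pairing (u (Suc n)) g - pairing (u n) g\<bar> < \<delta> * (1/2) ^ n\<close>[of g m] step.IH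
      by simp
  qed simp

  \<comment> \<open>Here \<open>a k\<close> is a squared \<open>L^2\<close> norm over \<Omega> and
    \<open>q m k\<close> a squared distance. The correction in \<open>b\<close> is twice the bound
    on the remaining drift, as the mixed term of the expanded square has coefficient 2.\<close>
  define a where "a k = pairing (u k) (cut (u k))" for k
  define b where "b k = a k - 4 * \<delta> * (1/2) ^ k" for k
  define q where "q m k = (LINT x|lebesgue. (norm (cut (u m) x - cut (u k) x))\<^sup>2)" for m k
  have int_cut: "integrable lebesgue (\<lambda>x. u m x \<bullet> cut (u k) x)" for m k
    using V_L_inf[OF u(2)] cut_L_1[OF u(2)] by (rule integrable_inner_L_inf_L_1)
  have sq_eq: "(norm (cut (u m) x - cut (u k) x))\<^sup>2 =
      u m x \<bullet> cut (u m) x + u k x \<bullet> cut (u k) x - 2 * (u m x \<bullet> cut (u k) x)" for m k x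
    by (simp add: cut_def power2_norm_eq_inner inner_diff_left inner_diff_right inner_commute
        indicator_def algebra_simps)
  have int_sq: "integrable lebesgue (\<lambda>x. (norm (cut (u m) x - cut (u k) x))\<^sup>2)" for m k
    unfolding sq_eq using int_cut by auto
  have q_eq: "q m k = a m + a k - 2 * pairing (u m) (cut (u k))" for m k
    unfolding q_def sq_eq a_def using int_cut by simp
  have q_nonneg: "q m k \<ge> 0" for m k
    by (simp add: q_def)
  \<comment> \<open>Almost orthogonality enters here: squared distances are dominated by increments
    of \<open>b\<close>, so a bound on \<open>b\<close> makes the cuts Cauchy in mean
    square.\<close>
  have q_le: "q m k \<le> b m - b k" if "k \<le> m" for m k
    using drift[OF that G(3)] by (simp add: q_eq a_def b_def algebra_simps)
  have "mono b"
    unfolding mono_def using q_le q_nonneg by (metis diff_ge_0_iff_ge order_trans)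
  moreover have "b k \<le> C\<^sup>2 * measure lebesgue \<Omega>" for k
  proof -
    have "a k \<le> (LINT x|lebesgue. C\<^sup>2 * indicator \<Omega> x)"
      unfolding a_def
    proof (rule integral_mono_AE)
      show "integrable lebesgue (\<lambda>x. C\<^sup>2 * indicator \<Omega> x)"
        using \<Omega>_meas by (intro integrable_mult_right integrable_real_indicator) (auto simp: fmeasurable_def)
      show "AE x in lebesgue. u k x \<bullet> cut (u k) x \<le> C\<^sup>2 * indicator \<Omega> x"
        using V_bound[OF u(2)[of k]]
        by eventually_elim (auto simp: cut_def indicator_def power2_norm_eq_inner[symmetric] intro: power_mono)
    qed (rule int_cut)
    also have "\<dots> = C\<^sup>2 * measure lebesgue \<Omega>"
      by simp
    finally have "a k \<le> C\<^sup>2 * measure lebesgue \<Omega>" .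
    moreover have "0 \<le> 4 * \<delta> * (1/2) ^ k"
      using \<delta>(1) by simp
    ultimately show ?thesis
      unfolding b_def by linarith
  qed
  ultimately obtain L where "b \<longlonglongrightarrow> L"
    using incseq_convergent[of b "C\<^sup>2 * measure lebesgue \<Omega>"] by blast
  then have "Cauchy b"
    by (rule LIMSEQ_imp_Cauchy)
  \<comment> \<open>Convergence in mean square is turned into convergence in \<open>L^1\<close>,
    from which an almost everywhere convergent subsequence is extracted.\<close>
  have "\<exists>N. \<forall>i\<ge>N. \<forall>j\<ge>N. (LINT x|lebesgue. norm (cut (u i) x - cut (u j) x)) < \<epsilon>" if "\<epsilon> > 0" for \<epsilon>
  proof -
    \<comment> \<open>Half of \<epsilon> is reserved for \<eta> times the measure of \<Omega>, the
      other half for \<open>q i j / \<eta>\<close>. The added 1 covers measure zero.\<close>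
    define \<eta> where "\<eta> = \<epsilon> / (2 * (measure lebesgue \<Omega> + 1))"
    have "measure lebesgue \<Omega> + 1 > 0"
      by (simp add: add_nonneg_pos)
    then have "\<eta> > 0"
      using \<open>\<epsilon> > 0\<close> by (simp add: \<eta>_def)
    have "\<eta> * measure lebesgue \<Omega> \<le> \<eta> * (measure lebesgue \<Omega> + 1)"
      using \<open>\<eta> > 0\<close> by simp
    also have "\<dots> = \<epsilon> / 2"
      using \<open>measure lebesgue \<Omega> + 1 > 0\<close> unfolding \<eta>_def by (simp add: field_simps)
    finally have \<eta>: "\<eta> * measure lebesgue \<Omega> \<le> \<epsilon> / 2" .
    obtain N where N: "\<And>m n. m \<ge> N \<Longrightarrow> n \<ge> N \<Longrightarrow> norm (b m - b n) < \<eta> * \<epsilon> / 2"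
      using CauchyD[OF \<open>Cauchy b\<close>, of "\<eta> * \<epsilon> / 2"] \<open>\<eta> > 0\<close> \<open>\<epsilon> > 0\<close> by auto
    have "(LINT x|lebesgue. norm (cut (u i) x - cut (u j) x)) < \<epsilon>" if "i \<ge> N" "j \<ge> N" for i j
    proof -
      have "q i j = q j i"
        unfolding q_def by (subst norm_minus_commute) simp
      then have "q i j < \<eta> * \<epsilon> / 2"
        using q_le[of i j] q_le[of j i] N[OF that] unfolding real_norm_def
        by (cases i j rule: le_cases) linarith+
      have "(LINT x|lebesgue. norm (cut (u i) x - cut (u j) x)) \<le>
          (LINT x|lebesgue. \<eta> * indicator \<Omega> x + (norm (cut (u i) x - cut (u j) x))\<^sup>2 / \<eta>)"
      proof (rule integral_mono)
        show "integrable lebesgue (\<lambda>x. norm (cut (u i) x - cut (u j) x))"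
          using cut_L_1[OF u(2)] by (auto simp: L_1_def)
        show "integrable lebesgue (\<lambda>x. \<eta> * indicator \<Omega> x + (norm (cut (u i) x - cut (u j) x))\<^sup>2 / \<eta>)"
          using \<Omega>_meas int_sq by (intro Bochner_Integration.integrable_add integrable_mult_right
              integrable_real_indicator integrable_divide) (auto simp: fmeasurable_def)
        \<comment> \<open>This takes the place of the Cauchy-Schwarz inequality: small values are
          charged to the measure of \<Omega>, large ones to the square.\<close>
        have small_or_large: "t \<le> \<eta> + t\<^sup>2 / \<eta>" if "t \<ge> 0" for t
        proof (cases "t \<le> \<eta>")
          case False
          then have "\<eta> * t \<le> t\<^sup>2"
            using that by (simp add: power2_eq_square mult_right_mono)
          then have "t \<le> t\<^sup>2 / \<eta>"
            using \<open>\<eta> > 0\<close> by (simp add: pos_le_divide_eq mult.commute)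
          then show ?thesis
            using \<open>\<eta> > 0\<close> by linarith
        qed (use \<open>\<eta> > 0\<close> in \<open>simp add: add_increasing2\<close>)
        show "norm (cut (u i) x - cut (u j) x) \<le>
            \<eta> * indicator \<Omega> x + (norm (cut (u i) x - cut (u j) x))\<^sup>2 / \<eta>" for x
          using small_or_large[of "norm (cut (u i) x - cut (u j) x)"]
          by (cases "x \<in> \<Omega>") (auto simp: cut_def)
      qed
      also have "\<dots> = \<eta> * measure lebesgue \<Omega> + q i j / \<eta>"
        using \<Omega>_meas int_sq unfolding q_def
        by (subst Bochner_Integration.integral_add) (auto simp: fmeasurable_def simp del: emeasure_completion)
      also have "\<dots> < \<epsilon>"
      proof -
        have "q i j / \<eta> < \<epsilon> / 2"
          using \<open>q i j < _\<close> \<open>\<eta> > 0\<close> by (simp add: field_simps)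
        with \<eta> have "\<eta> * measure lebesgue \<Omega> + q i j / \<eta> < \<epsilon> / 2 + \<epsilon> / 2"
          by (rule add_le_less_mono)
        then show ?thesis
          by simp
      qed
      finally show ?thesis .
    qed
    then show ?thesis
      by blast
  qed
  moreover have "integrable lebesgue (cut (u n))" for n
    using cut_L_1[OF u(2)] by (simp add: L_1_def)
  ultimately obtain r where r: "strict_mono r" "AE x in lebesgue. Cauchy (\<lambda>i. cut (u (r i)) x)"
    using cauchy_L1_AE_cauchy_subseq[of lebesgue "\<lambda>n. cut (u n)"] by blast

  \<comment> \<open>Inside \<Omega>, \<open>lim\<close> has an unspecified value where the
    subsequence diverges, which happens only on a null set.\<close>
  define v where "v x = (if x \<in> \<Omega> then lim (\<lambda>i. u (r i) x) else \<xi>)" for x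
  have [measurable]: "v \<in> borel_measurable lebesgue"
    unfolding v_def by measurable
  have "AE x in lebesgue. \<forall>n. x \<notin> \<Omega> \<longrightarrow> u n x = \<xi>"
    unfolding AE_all_countable using u(2) by (auto simp: V_set_def)
  with r(2) have lim: "AE x in lebesgue. (\<lambda>i. u (r i) x) \<longlonglongrightarrow> v x"
  proof eventually_elim
    case (elim x)
    show ?case
    proof (cases "x \<in> \<Omega>")
      case True
      then have "convergent (\<lambda>i. u (r i) x)"
        using elim(1) by (simp add: cut_def Cauchy_convergent_iff)
      then show ?thesis
        using True by (simp add: v_def convergent_LIMSEQ_iff)
    qed (use elim(2) in \<open>simp add: v_def\<close>)
  qed
  have "AE x in lebesgue. \<forall>n. norm (u n x) \<le> C"
    unfolding AE_all_countable using u(2) V_bound by blast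
  with lim have "AE x in lebesgue. norm (v x) \<le> C"
  proof eventually_elim
    case (elim x)
    show ?case
      by (rule Lim_bounded[OF tendsto_norm[OF elim(1)], of 0]) (use elim(2) in auto)
  qed
  then have "v \<in> L_inf"
    by (auto simp: L_inf_def)
  have pairing_lim: "(\<lambda>i. pairing (u (r i)) g) \<longlonglongrightarrow> pairing v g" if "g \<in> L_1" for g
    by (rule pairing_tendsto_dominated[where C = C]) (use V_bound u(2) lim that in auto)
  have "v \<in> T"
  proof (rule G0(4)[rule_format, OF \<open>v \<in> L_inf\<close>])
    fix g assume "g \<in> G0"
    then have g: "g \<in> G 0" "g \<in> L_1"
      using G(2) G0(2) by auto
    \<comment> \<open>The limit preserves only a weak inequality; the gap between
      \<open>2 * \<delta>\<close> and \<open>e\<close> makes it strict.\<close>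
    have "(\<lambda>i. \<bar>pairing (u (r i)) g - pairing u0 g\<bar>) \<longlonglongrightarrow> \<bar>pairing v g - pairing u0 g\<bar>"
      by (intro tendsto_intros pairing_lim g)
    moreover have "\<bar>pairing (u (r i)) g - pairing u0 g\<bar> \<le> 2 * \<delta>" for i
    proof -
      have "0 \<le> 2 * \<delta> * (1/2) ^ r i"
        using \<delta>(1) by simp
      then show ?thesis
        using drift[OF _ g(1), of "r i"] u(1) by simp
    qed
    ultimately have "\<bar>pairing v g - pairing u0 g\<bar> \<le> 2 * \<delta>"
      using Lim_bounded by blast
    then show "\<bar>pairing v g - pairing u0 g\<bar> < e"
      using \<delta>(3) by simp
  qed
  moreover have "distr_free A v"
    by (rule distr_free_limit[OF _ pairing_lim]) (use u(2) in \<open>auto simp: V_set_def\<close>)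
  moreover have "AE x in lebesgue. x \<in> \<Omega> \<longrightarrow> v x \<in> E"
  proof -
    define d where "d w = (\<integral>\<^sup>+x\<in>\<Omega>. edist_to (w x) E \<partial>lebesgue)" for w :: "real^'n \<Rightarrow> real^'d"
    have "(\<lambda>n. ennreal ((1/2) ^ n)) \<longlonglongrightarrow> ennreal 0"
      by (intro tendsto_ennrealI LIMSEQ_power_zero) auto
    \<comment> \<open>The estimates begin at index 1, since the starting map may be far from
      \<open>E\<close>.\<close>
    then have "(\<lambda>n. d (u (Suc n))) \<longlonglongrightarrow> 0"
      by (intro tendsto_sandwich[OF _ _ tendsto_const, of 0 "\<lambda>n. d (u (Suc n))"])
        (use step(3) in \<open>auto simp: d_def less_imp_le\<close>)
    then have "(\<lambda>n. d (u n)) \<longlonglongrightarrow> 0"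
      by (rule LIMSEQ_imp_Suc)
    then have "(\<lambda>i. d (u (r i))) \<longlonglongrightarrow> 0"
      using LIMSEQ_subseq_LIMSEQ[OF _ r(1)] by (auto simp: o_def)
    then have "liminf (\<lambda>i. d (u (r i))) = 0"
      by (simp add: lim_imp_Liminf)
    \<comment> \<open>By continuity of the distance to \<open>E\<close> the integrands converge
      almost everywhere, and Fatou's lemma gives the bound on \<open>d v\<close>.\<close>
    have "d v = (\<integral>\<^sup>+x. liminf (\<lambda>i. edist_to (u (r i) x) E * indicator \<Omega> x) \<partial>lebesgue)"
      unfolding d_def
    proof (rule nn_integral_cong_AE)
      show "AE x in lebesgue. edist_to (v x) E * indicator \<Omega> x =
          liminf (\<lambda>i. edist_to (u (r i) x) E * indicator \<Omega> x)"
        using lim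
      proof eventually_elim
        case (elim x)
        have "(\<lambda>i. edist_to (u (r i) x) E) \<longlonglongrightarrow> edist_to (v x) E"
          unfolding edist_to_infdist[OF E_nonempty]
          by (intro tendsto_ennrealI tendsto_infdist elim)
        then have "(\<lambda>i. edist_to (u (r i) x) E * indicator \<Omega> x) \<longlonglongrightarrow> edist_to (v x) E * indicator \<Omega> x"
          by (cases "x \<in> \<Omega>") auto
        then show ?case
          by (simp add: lim_imp_Liminf)
      qed
    qed
    also have "\<dots> \<le> liminf (\<lambda>i. d (u (r i)))"
      unfolding d_def by (rule nn_integral_liminf) measurable
    finally have "d v = 0"
      using \<open>liminf _ = 0\<close> by simp
    then have "AE x in lebesgue. edist_to (v x) E * indicator \<Omega> x = 0"
      unfolding d_def by (subst (asm) nn_integral_0_iff_AE) auto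
    \<comment> \<open>Distance zero means membership because \<open>E\<close> is closed.\<close>
    then show ?thesis
    proof eventually_elim
      case (elim x)
      then show ?case
        using in_closed_iff_infdist_zero[OF closed_E E_nonempty, of "v x"] infdist_nonneg[of "v x" E]
        by (auto simp: edist_to_infdist[OF E_nonempty])
    qed
  qed
  moreover have "v \<in> weak_star closure_of ?V"
    by (rule closure_of_weak_star_sequentially[OF _ _ \<open>v \<in> L_inf\<close> pairing_lim]) (use V_L_inf u(2) in auto)
  ultimately show ?thesis
    using that[of v] \<open>v \<in> L_inf\<close> by (simp add: v_def)
qed

lemma const_in_V_set:
  assumes "\<xi> \<in> E \<union> interior K"
  shows "(\<lambda>_. \<xi>) \<in> V_set A \<Omega> E K \<xi>"
  using assms by (simp add: V_set_def const_in_L_inf_piec distr_free_const)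

end

section \<open>Existence and weak* density of solutions\<close>

theorem theorem3p3:
  fixes A :: "'n::finite \<Rightarrow> real^'d^'m"
    and \<Omega> :: "(real^'n) set"
    and F :: "real^'d \<Rightarrow> real"
    and E K :: "(real^'d) set"
    and \<xi> :: "real^'d"
  assumes "full_rank_symbol A"
    and "bounded \<Omega>" and "open \<Omega>"
    and "continuous_on UNIV F" and "A_quasiconvex A F"
    and "E = {\<eta>. F \<eta> = 0}" and "K \<subseteq> {\<eta>. F \<eta> \<le> 0}"
    and "interior K \<noteq> {}"
    and "relaxation_property A K E"
    and "bounded E" and "bounded K"
    and "\<xi> \<in> E \<union> interior K"
  shows "(\<exists>u\<in>L_inf. distr_free A u \<and>
            (AE x in lebesgue. x \<in> \<Omega> \<longrightarrow> F (u x) = 0) \<and>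
            (AE x in lebesgue. x \<notin> \<Omega> \<longrightarrow> u x = \<xi>)) \<and>
         weak_star closure_of
            (solutions A \<Omega> F \<xi> \<inter> weak_star closure_of V_set A \<Omega> E K \<xi>)
          = weak_star closure_of V_set A \<Omega> E K \<xi>"
  proof -
  \<comment> \<open>Continuity of \<open>F\<close> makes its zero set closed, as the limit argument
    requires.\<close>
  have "closed E"
    using assms(4) unfolding assms(6) by (intro closed_Collect_eq) auto
  then interpret relaxable_pair A K E
    using assms by unfold_locales auto
  let ?V = "V_set A \<Omega> E K \<xi>"
  let ?S = "solutions A \<Omega> F \<xi> \<inter> weak_star closure_of ?V"
  have near: "\<exists>u. u \<in> T \<inter> ?S" if T: "u0 \<in> ?V" "openin weak_star T" "u0 \<in> T" for u0 T
  proof -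
    obtain u where "u \<in> T" "u \<in> L_inf" "distr_free A u"
        "AE x in lebesgue. x \<in> \<Omega> \<longrightarrow> u x \<in> E" "AE x in lebesgue. x \<notin> \<Omega> \<longrightarrow> u x = \<xi>"
        "u \<in> weak_star closure_of ?V"
      using exact_solution_near[OF assms(2,3) T] by blast
    then have "u \<in> T \<inter> ?S"
      by (simp add: solutions_def assms(6))
    then show ?thesis
      by blast
  qed
  have V: "?V \<subseteq> L_inf"
    using L_inf_piec_subset_L_inf by (auto simp: V_set_def)
  \<comment> \<open>The constant map is the starting point for existence; the whole space serves as
    its neighbourhood.\<close>
  have "(\<lambda>_. \<xi>) \<in> ?V"
    using const_in_V_set assms(12) by blast
  then obtain u where "u \<in> solutions A \<Omega> F \<xi>"
    using near[OF _ openin_topspace] V unfolding topspace_weak_star by blast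
  then have "\<exists>u\<in>L_inf. distr_free A u \<and> (AE x in lebesgue. x \<in> \<Omega> \<longrightarrow> F (u x) = 0) \<and>
      (AE x in lebesgue. x \<notin> \<Omega> \<longrightarrow> u x = \<xi>)"
    unfolding solutions_def by blast
  moreover have "weak_star closure_of ?S = weak_star closure_of ?V"
  proof (rule antisym)
    show "weak_star closure_of ?S \<subseteq> weak_star closure_of ?V"
      by (rule closure_of_minimal) auto
    \<comment> \<open>Approximating \<open>?V\<close> itself is enough, since a closed set
      containing it contains its closure.\<close>
    have "?V \<subseteq> weak_star closure_of ?S"
      unfolding in_closure_of subset_eq topspace_weak_star using near V by blast
    then show "weak_star closure_of ?V \<subseteq> weak_star closure_of ?S"
      by (rule closure_of_minimal) auto
  qed
  ultimately show ?thesis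
    by blast
qed

end
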